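(* Let $X$ be a Hausdorff topological vector space, let $N\ge 1$ and let $T_1,\dots,T_N$ be continuous linear operators on $X$. Let $Z\subset X$ be a set with $0\in Z$, such that the linear span of $Z$ is dense in $X$ and $T_i(Z)\subset Z$ for each $i=1,\dots,N$. Let $\mathcal{A}\subset\mathcal{P}(\mathbb{N})$ be a filter, and assume that the tuple of restrictions $T_1|_Z,\dots,T_N|_Z$, acting on $Z$ with the subspace topology, is disjoint $\mathcal{A}$-transitive. Then $T_1,\dots,T_N$ is disjoint $\mathcal{A}$-transitive on $X$.
   Context: $\mathbb{N}=\{0,1,2,\dots\}$. A family $\mathcal{A}\subset\mathcal{P}(\mathbb{N})$ is a Furstenberg family if every $A\in\mathcal{A}$ is infinite, and $A\in\mathcal{A}$, $A\subset B\subset\mathbb{N}$ imply $B\in\mathcal{A}$. It is a filter if moreover $A,B\in\mathcal{A}$ implies $A\cap B\in\mathcal{A}$. Let $Y$ be a Hausdorff topological space and $f_1,\dots,f_N$ continuous self-maps of $Y$. For non-empty open sets $U_0,U_1,\dots,U_N\subset Y$ the disjoint return set is $$\{m\in\mathbb{N}: U_0\cap f_1^{-m}(U_1)\cap\dots\cap f_N^{-m}(U_N)\neq\emptyset\},$$ where $f_i^{-m}(U)$ is the preimage of $U$ under the $m$-th iterate $f_i^m$. For a Furstenberg family $\mathcal{A}$, the tuple $f_1,\dots,f_N$ is disjoint $\mathcal{A}$-transitive if for all non-empty open sets $U_0,U_1,\dots,U_N\subset Y$ the disjoint return set belongs to $\mathcal{A}$. *)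

theory Defs
  imports "HOL-Analysis.Analysis"
begin

text \<open>Topological vector spaces. The class \<^class>\<open>real_normed_field\<close> covers both of the usual
  scalar fields, the reals and the complex numbers. Continuity of the vector addition (and of
  negation) is part of the class \<^class>\<open>topological_ab_group_add\<close>.\<close>

locale topological_vector_space = vector_space scale
  for scale :: "'k::real_normed_field \<Rightarrow> 'a::topological_ab_group_add \<Rightarrow> 'a" +
  assumes continuous_scale: "continuous_on UNIV (\<lambda>(c, x). scale c x)"

definition furstenberg_family :: "nat set set \<Rightarrow> bool" where
  "furstenberg_family \<A> \<longleftrightarrow>
     (\<forall>A\<in>\<A>. infinite A) \<and> (\<forall>A B. A \<in> \<A> \<longrightarrow> A \<subseteq> B \<longrightarrow> B \<in> \<A>)"

definition furstenberg_filter :: "nat set set \<Rightarrow> bool" where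
  "furstenberg_filter \<A> \<longleftrightarrow>
     furstenberg_family \<A> \<and> (\<forall>A\<in>\<A>. \<forall>B\<in>\<A>. A \<inter> B \<in> \<A>)"

text \<open>A tuple of \<open>N\<close> self-maps of the space \<open>Y\<close> is a function \<open>f\<close> of which only the values
  \<open>f 1, \<dots>, f N\<close> matter; the \<open>N + 1\<close> open sets are \<open>U 0, \<dots>, U N\<close>. The two definitions below are
  meant for continuous self-maps of a Hausdorff space \<open>Y\<close>; since HOL functions are total,
  preimages are taken inside \<open>topspace Y\<close>.\<close>

definition disjoint_return_set ::
    "'a topology \<Rightarrow> nat \<Rightarrow> (nat \<Rightarrow> 'a \<Rightarrow> 'a) \<Rightarrow> (nat \<Rightarrow> 'a set) \<Rightarrow> nat set" where
  "disjoint_return_set Y N f U =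
     {m. U 0 \<inter> (\<Inter>i\<in>{1..N}. (f i ^^ m) -` U i \<inter> topspace Y) \<noteq> {}}"

definition disjoint_transitive ::
    "nat set set \<Rightarrow> 'a topology \<Rightarrow> nat \<Rightarrow> (nat \<Rightarrow> 'a \<Rightarrow> 'a) \<Rightarrow> bool" where
  "disjoint_transitive \<A> Y N f \<longleftrightarrow>
     (\<forall>U. (\<forall>i\<in>{0..N}. openin Y (U i) \<and> U i \<noteq> {}) \<longrightarrow> disjoint_return_set Y N f U \<in> \<A>)"

end

theory Submission
  imports Defs
begin

text \<open>Call a tuple \<open>u\<^sub>0, \<dots>, u\<^sub>N\<close> attainable if the disjoint return set of any open
  neighbourhoods of its entries is in \<open>\<A>\<close>. As \<open>\<A>\<close> is a filter and the \<open>T\<^sub>i\<close> are linear,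
  attainable tuples form a linear subspace of \<open>X\<^sup>N\<^sup>+\<^sup>1\<close>, so they include the span of the
  tuples with entries in \<open>Z\<close>. Since \<open>0 \<in> Z\<close>, that span is the set of all tuples with entries in
  the span of \<open>Z\<close>, and these meet every product of non-empty open sets.\<close>

definition attainable ::
    "nat set set \<Rightarrow> nat \<Rightarrow> (nat \<Rightarrow> 'a \<Rightarrow> 'a) \<Rightarrow> (nat \<Rightarrow> 'a::topological_space) \<Rightarrow> bool" where
  "attainable \<A> N T u \<longleftrightarrow>
     (\<forall>U. (\<forall>i\<in>{0..N}. open (U i) \<and> u i \<in> U i) \<longrightarrow> disjoint_return_set euclidean N T U \<in> \<A>)"

lemma attainableI:
  assumes "\<And>U. (\<And>i. i \<le> N \<Longrightarrow> open (U i)) \<Longrightarrow> (\<And>i. i \<le> N \<Longrightarrow> u i \<in> U i) \<Longrightarrow>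
    disjoint_return_set euclidean N T U \<in> \<A>"
  shows "attainable \<A> N T u"
  using assms unfolding attainable_def by auto

lemma attainableD:
  assumes "attainable \<A> N T u" "\<And>i. i \<le> N \<Longrightarrow> open (U i)" "\<And>i. i \<le> N \<Longrightarrow> u i \<in> U i"
  shows "disjoint_return_set euclidean N T U \<in> \<A>"
  using assms unfolding attainable_def by auto

lemma attainable_cong:
  assumes "attainable \<A> N T u" "\<And>i. i \<le> N \<Longrightarrow> u i = v i"
  shows "attainable \<A> N T v"
  using assms unfolding attainable_def by auto

lemma mem_disjoint_return_set_euclidean:
  "m \<in> disjoint_return_set euclidean N T U \<longleftrightarrow> (\<exists>x\<in>U 0. \<forall>i\<in>{1..N}. (T i ^^ m) x \<in> U i)"
  unfolding disjoint_return_set_def by auto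

lemma furstenberg_filter_superset:
  assumes "furstenberg_filter \<A>" "A \<in> \<A>" "A \<subseteq> B"
  shows "B \<in> \<A>"
  using assms unfolding furstenberg_filter_def furstenberg_family_def by blast

lemma furstenberg_filter_Int:
  assumes "furstenberg_filter \<A>" "A \<in> \<A>" "B \<in> \<A>"
  shows "A \<inter> B \<in> \<A>"
  using assms unfolding furstenberg_filter_def by blast

lemma funpow_additive:
  fixes f :: "'a::plus \<Rightarrow> 'a"
  assumes "\<And>x y. f (x + y) = f x + f y"
  shows "(f ^^ m) (x + y) = (f ^^ m) x + (f ^^ m) y"
  by (induction m) (simp_all add: assms)

lemma funpow_commute:
  fixes f g :: "'a \<Rightarrow> 'a"
  assumes "\<And>x. f (g x) = g (f x)"
  shows "(f ^^ m) (g x) = g ((f ^^ m) x)"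
  by (induction m) (simp_all add: assms)

text \<open>Addition is jointly continuous, so the preimage of \<open>U\<close> is open in the
  product space and contains an open box around \<open>(x, y)\<close>.\<close>

lemma open_add_neighbourhoods:
  fixes x y :: "'a::topological_monoid_add"
  assumes "open U" "x + y \<in> U"
  obtains V W where "open V" "open W" "x \<in> V" "y \<in> W" "\<And>a b. a \<in> V \<Longrightarrow> b \<in> W \<Longrightarrow> a + b \<in> U"
proof -
  have "open ((\<lambda>p. fst p + snd p) -` U :: ('a \<times> 'a) set)"
    by (rule open_vimage[OF assms(1)]) (intro continuous_intros)
  then obtain V W where "open V" "open W" "(x, y) \<in> V \<times> W" "V \<times> W \<subseteq> (\<lambda>p. fst p + snd p) -` U"
    using assms(2) by (elim open_prod_elim[where x = "(x, y)"]) auto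
  then show thesis
    by (intro that[of V W]) auto
qed

text \<open>Each neighbourhood of \<open>u i + v i\<close> contains a sum of neighbourhoods of
  \<open>u i\<close> and \<open>v i\<close>. At a time common to the two return sets, the sum of the
  two witnesses is a witness for \<open>U\<close>, since iterates of additive maps are additive.
  Closure of \<open>\<A>\<close> under intersection provides enough common times.\<close>

lemma attainable_add:
  fixes u v :: "nat \<Rightarrow> 'a::topological_monoid_add"
  assumes "furstenberg_filter \<A>" "\<And>i x y. i \<in> {1..N} \<Longrightarrow> T i (x + y) = T i x + T i y"
    and u: "attainable \<A> N T u" and v: "attainable \<A> N T v"
  shows "attainable \<A> N T (\<lambda>i. u i + v i)"
proof (rule attainableI)
  fix U assume U: "\<And>i. i \<le> N \<Longrightarrow> open (U i)" "\<And>i. i \<le> N \<Longrightarrow> u i + v i \<in> U i"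
  \<comment> \<open>Both neighbourhoods are packed into one pair, and the bound on \<open>i\<close>
    sits under the quantifier, so that a single choice yields a function \<open>P\<close> on all
    indices.\<close>
  have "\<exists>P. i \<le> N \<longrightarrow> open (fst P) \<and> open (snd P) \<and> u i \<in> fst P \<and> v i \<in> snd P
      \<and> (\<forall>a\<in>fst P. \<forall>b\<in>snd P. a + b \<in> U i)" for i
  proof (cases "i \<le> N")
    case True
    obtain V W where "open V" "open W" "u i \<in> V" "v i \<in> W"
      "\<And>a b. a \<in> V \<Longrightarrow> b \<in> W \<Longrightarrow> a + b \<in> U i"
      using open_add_neighbourhoods[OF U[OF True]] by blast
    then show ?thesis by (intro exI[of _ "(V, W)"]) simp
  qed simp
  then obtain P where P: "\<And>i. i \<le> N \<longrightarrow> open (fst (P i)) \<and> open (snd (P i)) \<and>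
      u i \<in> fst (P i) \<and> v i \<in> snd (P i) \<and> (\<forall>a\<in>fst (P i). \<forall>b\<in>snd (P i). a + b \<in> U i)"
    by metis
  define V W where "V i = fst (P i)" and "W i = snd (P i)" for i
  have VW: "open (V i)" "open (W i)" "u i \<in> V i" "v i \<in> W i" if "i \<le> N" for i
    using P that by (simp_all add: V_def W_def)
  have sum: "a + b \<in> U i" if "i \<le> N" "a \<in> V i" "b \<in> W i" for i a b
    using P that by (simp add: V_def W_def)
  let ?R = "disjoint_return_set euclidean N T"
  have "?R V \<inter> ?R W \<in> \<A>"
    by (intro furstenberg_filter_Int[OF assms(1)] attainableD[OF u] attainableD[OF v] VW)
  moreover have "?R V \<inter> ?R W \<subseteq> ?R U"
  proof
    fix m assume "m \<in> ?R V \<inter> ?R W"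
    then obtain x y where "x \<in> V 0" "\<forall>i\<in>{1..N}. (T i ^^ m) x \<in> V i"
      "y \<in> W 0" "\<forall>i\<in>{1..N}. (T i ^^ m) y \<in> W i"
      by (auto simp: mem_disjoint_return_set_euclidean)
    moreover have "(T i ^^ m) (x + y) = (T i ^^ m) x + (T i ^^ m) y" if "i \<in> {1..N}" for i
      by (rule funpow_additive) (rule assms(2)[OF that])
    ultimately have "x + y \<in> U 0" "\<forall>i\<in>{1..N}. (T i ^^ m) (x + y) \<in> U i"
      by (simp_all add: sum)
    then show "m \<in> ?R U"
      unfolding mem_disjoint_return_set_euclidean by blast
  qed
  ultimately show "?R U \<in> \<A>"
    by (rule furstenberg_filter_superset[OF assms(1)])
qed

text \<open>Meant for \<open>g\<close> = multiplication by a fixed scalar. The neighbourhoods are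
  pulled back along \<open>g\<close> and the witness is pushed forward, so \<open>g\<close> need not
  be open and the scalar 0 is covered too.\<close>

lemma attainable_commuting_image:
  fixes g :: "'a::topological_space \<Rightarrow> 'a"
  assumes "furstenberg_filter \<A>" "\<And>i x. i \<in> {1..N} \<Longrightarrow> T i (g x) = g (T i x)"
    and cont: "continuous_on UNIV g" and u: "attainable \<A> N T u"
  shows "attainable \<A> N T (\<lambda>i. g (u i))"
proof (rule attainableI)
  fix U assume U: "\<And>i. i \<le> N \<Longrightarrow> open (U i)" "\<And>i. i \<le> N \<Longrightarrow> g (u i) \<in> U i"
  let ?R = "disjoint_return_set euclidean N T"
  have "?R (\<lambda>i. g -` U i) \<in> \<A>"
    using U by (intro attainableD[OF u]) (auto intro: open_vimage cont)
  moreover have "?R (\<lambda>i. g -` U i) \<subseteq> ?R U"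
  proof
    fix m assume "m \<in> ?R (\<lambda>i. g -` U i)"
    then obtain x where x: "g x \<in> U 0" "\<forall>i\<in>{1..N}. g ((T i ^^ m) x) \<in> U i"
      by (auto simp: mem_disjoint_return_set_euclidean)
    have "(T i ^^ m) (g x) = g ((T i ^^ m) x)" if "i \<in> {1..N}" for i
      by (rule funpow_commute) (rule assms(2)[OF that])
    with x have "\<forall>i\<in>{1..N}. (T i ^^ m) (g x) \<in> U i"
      by simp
    with x(1) show "m \<in> ?R U"
      unfolding mem_disjoint_return_set_euclidean by blast
  qed
  ultimately show "?R U \<in> \<A>"
    by (rule furstenberg_filter_superset[OF assms(1)])
qed

text \<open>\<open>restrict f Z\<close> takes the value \<open>undefined\<close> off
  \<open>Z\<close>, so the iterates agree only because the orbit never leaves \<open>Z\<close>; the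
  induction carries this membership along.\<close>

lemma funpow_restrict_invariant:
  fixes f :: "'a \<Rightarrow> 'a"
  assumes "f ` Z \<subseteq> Z" "x \<in> Z"
  shows "(restrict f Z ^^ m) x = (f ^^ m) x"
proof -
  have "(restrict f Z ^^ m) x = (f ^^ m) x \<and> (f ^^ m) x \<in> Z"
    using assms by (induction m) auto
  then show ?thesis ..
qed

text \<open>The traces \<open>Z \<inter> U i\<close> are relatively open and contain
  \<open>u i\<close>, so transitivity on \<open>Z\<close> applies to them; by invariance, a witness
  for the restrictions is one for \<open>T\<close>.\<close>

lemma attainable_invariant_subset:
  fixes Z :: "'a::topological_space set"
  assumes "furstenberg_filter \<A>" and inv: "\<And>i. i \<in> {1..N} \<Longrightarrow> T i ` Z \<subseteq> Z"
    and trans: "disjoint_transitive \<A> (top_of_set Z) N (\<lambda>i. restrict (T i) Z)"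
    and u: "\<And>i. i \<le> N \<Longrightarrow> u i \<in> Z"
  shows "attainable \<A> N T u"
proof (rule attainableI)
  fix U assume U: "\<And>i. i \<le> N \<Longrightarrow> open (U i)" "\<And>i. i \<le> N \<Longrightarrow> u i \<in> U i"
  let ?S = "disjoint_return_set (top_of_set Z) N (\<lambda>i. restrict (T i) Z) (\<lambda>i. Z \<inter> U i)"
  have "Z \<inter> U i \<noteq> {}" if "i \<le> N" for i
    using U(2)[OF that] u[OF that] by blast
  then have "\<forall>i\<in>{0..N}. openin (top_of_set Z) (Z \<inter> U i) \<and> Z \<inter> U i \<noteq> {}"
    using U(1) by (simp add: openin_open_Int)
  then have "?S \<in> \<A>"
    by (rule trans[unfolded disjoint_transitive_def, THEN spec, THEN mp])
  moreover have "?S \<subseteq> disjoint_return_set euclidean N T U"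
  proof
    fix m assume "m \<in> ?S"
    then obtain x where "x \<in> Z" "x \<in> U 0" "\<forall>i\<in>{1..N}. (restrict (T i) Z ^^ m) x \<in> U i"
      unfolding disjoint_return_set_def by blast
    moreover have "(restrict (T i) Z ^^ m) x = (T i ^^ m) x" if "i \<in> {1..N}" for i
      by (rule funpow_restrict_invariant[OF inv[OF that] \<open>x \<in> Z\<close>])
    ultimately show "m \<in> disjoint_return_set euclidean N T U"
      unfolding mem_disjoint_return_set_euclidean by (intro bexI[of _ x]) simp_all
  qed
  ultimately show "disjoint_return_set euclidean N T U \<in> \<A>"
    by (rule furstenberg_filter_superset[OF assms(1)])
qed

theorem theorem2p7:
  fixes scale :: "'k::real_normed_field \<Rightarrow> 'a::{topological_ab_group_add, t2_space} \<Rightarrow> 'a"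
    and N :: nat
    and T :: "nat \<Rightarrow> 'a \<Rightarrow> 'a"
    and Z :: "'a set"
    and \<A> :: "nat set set"
  assumes "topological_vector_space scale"
    and "N \<ge> 1"
    and "\<And>i. i \<in> {1..N} \<Longrightarrow> Vector_Spaces.linear scale scale (T i)"
    and "\<And>i. i \<in> {1..N} \<Longrightarrow> continuous_on UNIV (T i)"
    and "0 \<in> Z"
    and "closure (module.span scale Z) = UNIV"
    and "\<And>i. i \<in> {1..N} \<Longrightarrow> T i ` Z \<subseteq> Z"
    and "furstenberg_filter \<A>"
    and "disjoint_transitive \<A> (top_of_set Z) N (\<lambda>i. restrict (T i) Z)"
  shows "disjoint_transitive \<A> euclidean N T"
proof -
  interpret topological_vector_space scale by fact
  note filter = assms(8)
  have T_add: "T i (x + y) = T i x + T i y" if "i \<in> {1..N}" for i x y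
    using module_hom.add[of scale scale "T i"] assms(3)[OF that] by (simp add: linear_iff_module_hom)
  have T_scale: "T i (scale c x) = scale c (T i x)" if "i \<in> {1..N}" for i c x
    using module_hom.scale[of scale scale "T i"] assms(3)[OF that] by (simp add: linear_iff_module_hom)
  have cont: "continuous_on UNIV (scale c)" for c
    using continuous_on_compose2[OF continuous_scale, of UNIV "\<lambda>x. (c, x)"]
    by (simp add: continuous_on_Pair)
  have add: "attainable \<A> N T (\<lambda>i. u i + v i)" if "attainable \<A> N T u" "attainable \<A> N T v" for u v
    by (rule attainable_add[OF filter _ that]) (rule T_add)
  have smul: "attainable \<A> N T (\<lambda>i. scale c (u i))" if "attainable \<A> N T u" for c u
    by (rule attainable_commuting_image[OF filter _ cont that]) (rule T_scale)
  note tuple_in_Z = attainable_invariant_subset[OF filter assms(7) assms(9)]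
  \<comment> \<open>Span induction handles one vector at a time, hence tuples with a single entry
    that may be nonzero.\<close>
  have single: "attainable \<A> N T (\<lambda>i. if i = k then z else 0)" if "z \<in> span Z" for k z
    using that
  proof (induction rule: span_induct_alt)
    case base
    show ?case using assms(5) by (intro tuple_in_Z) auto
  next
    case (step c x y)
    \<comment> \<open>Here \<open>0 \<in> Z\<close> is essential: it puts the entries away from
      \<open>k\<close> into \<open>Z\<close> as well.\<close>
    have "attainable \<A> N T (\<lambda>i. if i = k then x else 0)"
      using step assms(5) by (intro tuple_in_Z) auto
    from add[OF smul[OF this] step.IH] show ?case
      by (rule attainable_cong) auto
  qed
  have span: "attainable \<A> N T u" if u: "\<And>i. u i \<in> span Z" for u
  proof -
    \<comment> \<open>The tuple is filled in coordinate by coordinate. There are N + 1 coordinates,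
      so \<open>k = Suc N\<close> completes it.\<close>
    have "attainable \<A> N T (\<lambda>i. if i < k then u i else 0)" for k
    proof (induction k)
      case 0
      show ?case using assms(5) by (intro tuple_in_Z) auto
    next
      case (Suc k)
      from add[OF Suc single[OF u, of k]] show ?case
        by (rule attainable_cong) (auto simp: less_Suc_eq)
    qed
    from this[of "Suc N"] show ?thesis
      by (rule attainable_cong) auto
  qed
  show ?thesis
    unfolding disjoint_transitive_def
  proof (intro allI impI)
    fix U :: "nat \<Rightarrow> 'a set"
    assume U: "\<forall>i\<in>{0..N}. openin euclidean (U i) \<and> U i \<noteq> {}"
    \<comment> \<open>For indices beyond \<open>N\<close> the vector 0 serves as default, because
      \<open>span\<close> asks for every entry to lie in the span.\<close>
    have "\<exists>x\<in>span Z. i \<le> N \<longrightarrow> x \<in> U i" for i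
    proof (cases "i \<le> N")
      case True
      with U have "open (U i)" "U i \<noteq> {}" by auto
      \<comment> \<open>Density: an open set missing the span would also miss its closure, which is
        the whole space.\<close>
      then have "U i \<inter> span Z \<noteq> {}"
        using open_Int_closure_eq_empty[of "U i" "span Z"] assms(6) by simp
      then show ?thesis by blast
    qed (auto intro: span_zero)
    then obtain u where "\<And>i. u i \<in> span Z" "\<And>i. i \<le> N \<Longrightarrow> u i \<in> U i"
      by metis
    with U show "disjoint_return_set euclidean N T U \<in> \<A>"
      by (intro attainableD[OF span]) auto
  qed
qed

end
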